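(* Let $H_n$ be the pyrene system with $n$ pyrene fragments, let $\Phi_n$ be the number of perfect matchings of $H_n$, and let $AF_n=\sum_{M}af(H_n,M)$, the sum over all perfect matchings $M$ of $H_n$. Then $$\lim_{n\to\infty}\frac{AF_n}{n\,\Phi_n}=1+\frac{3\sqrt{2}}{4}.$$
   Context: Pyrene system: draw the hexagonal lattice so that every hexagon has two vertical sides; horizontally adjacent hexagons then share a vertical edge. For $n\ge1$, $H_n$ is the hexagonal system (the plane graph formed by the vertices and edges of the following $4n$ hexagons) consisting of a horizontal linear row of $2n$ hexagons $h_{1,1},h_{1,2},\dots,h_{n,1},h_{n,2}$, consecutive ones sharing a vertical edge, together with, for each $i$, a hexagon $s_{i,1}$ directly above and a hexagon $s_{i,2}$ directly below the common edge of $h_{i,1}$ and $h_{i,2}$ (each sharing an edge with both $h_{i,1}$ and $h_{i,2}$). For a perfect matching $M$ of $G$, an anti-forcing set of $M$ is a set $S\subseteq E(G)\setminus M$ such that $M$ is the unique perfect matching of $G-S$; the anti-forcing number $af(G,M)$ is the minimum size of an anti-forcing set of $M$. *)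

theory Defs
  imports Complex_Main
begin

type_synonym vert = "int \<times> int"

text \<open>Hexagonal lattice in brick-wall coordinates: the hexagon with lower-left corner (a,b)
(a+b even) is the 6-cycle (a,b),(a+1,b),(a+2,b),(a+2,b+1),(a+1,b+1),(a,b+1).
Its two vertical sides are x=a and x=a+2; horizontally adjacent hexagons share a vertical side,
and the hexagon with corner (a+1,b+1) sits directly above the common vertical edge of the
hexagons with corners (a,b) and (a+2,b).\<close>

definition hexagon :: "vert \<Rightarrow> vert set set" where
  "hexagon c = (case c of (a, b) \<Rightarrow>
     {{(a,b),(a+1,b)}, {(a+1,b),(a+2,b)}, {(a+2,b),(a+2,b+1)},
      {(a+2,b+1),(a+1,b+1)}, {(a+1,b+1),(a,b+1)}, {(a,b+1),(a,b)}})"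

text \<open>Corners of the 4n hexagons of H_n (0-indexed i < n):
 h_{i,1} at (4i,0), h_{i,2} at (4i+2,0), s_{i,1} at (4i+1,1) above, s_{i,2} at (4i+1,-1) below.\<close>

definition pyrene_corners :: "nat \<Rightarrow> vert set" where
  "pyrene_corners n = (\<Union>i\<in>{..<n}.
     {(4 * int i, 0), (4 * int i + 2, 0), (4 * int i + 1, 1), (4 * int i + 1, -1)})"

definition pyrene_edges :: "nat \<Rightarrow> vert set set" where
  "pyrene_edges n = \<Union> (hexagon ` pyrene_corners n)"

definition pyrene_verts :: "nat \<Rightarrow> vert set" where
  "pyrene_verts n = \<Union> (pyrene_edges n)"

definition perfect_matching :: "'a set \<Rightarrow> 'a set set \<Rightarrow> 'a set set \<Rightarrow> bool" where
  "perfect_matching V E M \<longleftrightarrow> M \<subseteq> E \<and> (\<forall>v\<in>V. \<exists>!e. e \<in> M \<and> v \<in> e)"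

definition anti_forcing_set :: "'a set \<Rightarrow> 'a set set \<Rightarrow> 'a set set \<Rightarrow> 'a set set \<Rightarrow> bool" where
  "anti_forcing_set V E M S \<longleftrightarrow> S \<subseteq> E - M \<and> perfect_matching V (E - S) M \<and>
     (\<forall>M'. perfect_matching V (E - S) M' \<longrightarrow> M' = M)"

definition af :: "'a set \<Rightarrow> 'a set set \<Rightarrow> 'a set set \<Rightarrow> nat" where
  "af V E M = Min (card ` {S. anti_forcing_set V E M S})"

definition pyrene_Phi :: "nat \<Rightarrow> nat" where
  "pyrene_Phi n = card {M. perfect_matching (pyrene_verts n) (pyrene_edges n) M}"

definition pyrene_AF :: "nat \<Rightarrow> nat" where
  "pyrene_AF n = (\<Sum>M\<in>{M. perfect_matching (pyrene_verts n) (pyrene_edges n) M}.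
                    af (pyrene_verts n) (pyrene_edges n) M)"

end

theory Submission
  imports Defs
begin

text \<open>
  Cut \<open>H_n\<close> at the vertical edges shared by consecutive fragments. Inside a fragment a perfect
  matching looks in one of six ways: either each of the two outer hexagons is matched within itself
  (four ways, \<open>N a b\<close>), or the fragment also covers both ends of its left (\<open>Lf\<close>) or right (\<open>Rt\<close>)
  border edge. So perfect matchings are words over six letters in which \<open>Rt\<close> is never followed by \<open>Lf\<close>.

  The anti-forcing number of a word is the sum of the letter weights \<open>3\<close> for \<open>N a a\<close>, \<open>2\<close> for the other
  \<open>N a b\<close>, and \<open>1\<close> for \<open>Lf\<close> and \<open>Rt\<close>. Deleting that many suitable edges per fragment forces the
  \<open>N\<close>-letters locally, then the \<open>Lf\<close>-letters from left to right and the \<open>Rt\<close>-letters from right to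
  left. Conversely, there are that many words whose matchings use pairwise disjoint sets of new
  edges, and an anti-forcing set has to meet each of these sets.

  A linear recursion for the number of words and their total weight then gives the limit.
\<close>

section \<open>Labelling the vertices and edges of a pyrene system\<close>

text \<open>Fragment \<open>i\<close> occupies the columns \<open>4i, ..., 4i+4\<close>; its outer columns are shared with its
  neighbours and are numbered 0 and 4 in the slots. The boolean tells the upper half (\<open>True\<close>) from
  the lower one. \<open>Core\<close> vertices lie in the rows 0 and 1 and \<open>Cap\<close> vertices in the rows -1 and 2;
  accordingly \<open>S\<close>, \<open>T\<close> and \<open>P\<close> slots are core edges, cap edges and the vertical edges joining the
  two. \<open>Mid i\<close> is the edge between the two inner hexagons, \<open>Bd i\<close> the left border edge.\<close>

datatype col = C1 | C2 | C3

datatype node = Core nat bool col | Cap nat bool col | Border nat bool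

datatype slot = S01 | S12 | S23 | S34 | P1 | T12 | T23 | P3

datatype edge = Side nat bool slot | Mid nat | Bd nat

fun col_x :: "col \<Rightarrow> int" where
  "col_x C1 = 1" | "col_x C2 = 2" | "col_x C3 = 3"

fun pos :: "node \<Rightarrow> vert" where
  "pos (Core i s c) = (4 * int i + col_x c, if s then 1 else 0)"
| "pos (Cap i s c) = (4 * int i + col_x c, if s then 2 else -1)"
| "pos (Border i s) = (4 * int i, if s then 1 else 0)"

fun ends :: "edge \<Rightarrow> node set" where
  "ends (Side i s S01) = {Border i s, Core i s C1}"
| "ends (Side i s S12) = {Core i s C1, Core i s C2}"
| "ends (Side i s S23) = {Core i s C2, Core i s C3}"
| "ends (Side i s S34) = {Core i s C3, Border (Suc i) s}"
| "ends (Side i s P1) = {Core i s C1, Cap i s C1}"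
| "ends (Side i s T12) = {Cap i s C1, Cap i s C2}"
| "ends (Side i s T23) = {Cap i s C2, Cap i s C3}"
| "ends (Side i s P3) = {Core i s C3, Cap i s C3}"
| "ends (Mid i) = {Core i False C2, Core i True C2}"
| "ends (Bd i) = {Border i False, Border i True}"

definition drawn :: "edge \<Rightarrow> vert set" where
  "drawn e = pos ` ends e"

fun star :: "node \<Rightarrow> edge set" where
  "star (Core i s C1) = {Side i s S01, Side i s S12, Side i s P1}"
| "star (Core i s C2) = {Side i s S12, Side i s S23, Mid i}"
| "star (Core i s C3) = {Side i s S23, Side i s S34, Side i s P3}"
| "star (Cap i s C1) = {Side i s P1, Side i s T12}"
| "star (Cap i s C2) = {Side i s T12, Side i s T23}"
| "star (Cap i s C3) = {Side i s T23, Side i s P3}"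
| "star (Border 0 s) = {Bd 0, Side 0 s S01}"
| "star (Border (Suc i) s) = {Bd (Suc i), Side (Suc i) s S01, Side i s S34}"

definition pyr_labels :: "nat \<Rightarrow> edge set" where
  "pyr_labels n = {Side i s k | i s k. i < n} \<union> {Mid i | i. i < n} \<union> {Bd i | i. i \<le> n}"

definition pyr_nodes :: "nat \<Rightarrow> node set" where
  "pyr_nodes n = {Core i s c | i s c. i < n} \<union> {Cap i s c | i s c. i < n} \<union> {Border i s | i s. i \<le> n}"

lemma UNIV_slot: "UNIV = {S01, S12, S23, S34, P1, T12, T23, P3}"
  using slot.exhaust by auto

lemma four_mult_add_eq_iff:
  fixes a b :: int
  assumes "0 \<le> a" "a < 4" "0 \<le> b" "b < 4"
  shows "4 * int i + a = 4 * int j + b \<longleftrightarrow> i = j \<and> a = b"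
  using assms by presburger

lemma inj_pos: "inj pos"
proof (rule injI)
  have col: "0 \<le> col_x c" "col_x c < 4" "col_x c \<noteq> 0" for c
    by (cases c; simp)+
  have col_inj: "col_x c = col_x d \<longleftrightarrow> c = d" for c d
    by (cases c; cases d; simp)
  fix v w assume "pos v = pos w"
  then show "v = w"
    using four_mult_add_eq_iff[OF col(1,2) col(1,2)] four_mult_add_eq_iff[of 0 "col_x c" for c, OF _ _ col(1,2)]
      four_mult_add_eq_iff[of "col_x c" 0 for c, OF col(1,2)] col(3)
    by (cases v; cases w; force simp: col_inj split: if_splits)
qed

lemma inj_ends: "inj ends"
proof (rule injI)
  fix e f assume "ends e = ends f"
  then show "e = f"
    by (cases e rule: ends.cases; cases f rule: ends.cases; simp add: doubleton_eq_iff)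
qed

lemma inj_drawn: "inj drawn"
  unfolding drawn_def using inj_ends inj_pos by (simp add: inj_def inj_image_eq_iff[OF inj_pos])

lemma mem_ends_iff_star: "v \<in> ends e \<longleftrightarrow> e \<in> star v"
  by (cases e rule: ends.cases; cases v rule: star.cases; auto)

lemma pos_mem_drawn_iff: "pos v \<in> drawn e \<longleftrightarrow> e \<in> star v"
  unfolding drawn_def by (simp add: inj_image_mem_iff[OF inj_pos] mem_ends_iff_star)

lemma hexagon_left:
  "hexagon (4 * int i, 0) =
    drawn ` {Bd i, Side i True S01, Side i True S12, Side i False S01, Side i False S12, Mid i}"
  unfolding hexagon_def drawn_def by (auto simp: insert_commute)

lemma hexagon_right:
  "hexagon (4 * int i + 2, 0) =
    drawn ` {Bd (Suc i), Side i True S34, Side i True S23, Side i False S34, Side i False S23, Mid i}"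
  unfolding hexagon_def drawn_def by (auto simp: insert_commute algebra_simps)

lemma hexagon_above:
  "hexagon (4 * int i + 1, 1) = drawn ` (Side i True ` {S12, S23, P1, T12, T23, P3})"
  unfolding hexagon_def drawn_def by (auto simp: insert_commute algebra_simps)

lemma hexagon_below:
  "hexagon (4 * int i + 1, -1) = drawn ` (Side i False ` {S12, S23, P1, T12, T23, P3})"
  unfolding hexagon_def drawn_def by (auto simp: insert_commute algebra_simps)

definition fragment :: "nat \<Rightarrow> edge set" where
  "fragment i = {Bd i, Bd (Suc i), Mid i} \<union> range (Side i True) \<union> range (Side i False)"

lemma mem_pyr_labels [simp]:
  "Side i s k \<in> pyr_labels n \<longleftrightarrow> i < n" "Mid i \<in> pyr_labels n \<longleftrightarrow> i < n"
  "Bd i \<in> pyr_labels n \<longleftrightarrow> i \<le> n"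
  by (auto simp: pyr_labels_def)

lemma mem_pyr_nodes [simp]:
  "Core i s c \<in> pyr_nodes n \<longleftrightarrow> i < n" "Cap i s c \<in> pyr_nodes n \<longleftrightarrow> i < n"
  "Border i s \<in> pyr_nodes n \<longleftrightarrow> i \<le> n"
  by (auto simp: pyr_nodes_def)

lemma UN_fragment:
  assumes "n > 0"
  shows "(\<Union>i<n. fragment i) = pyr_labels n"
proof -
  have "e \<in> (\<Union>i<n. fragment i)" if e: "e \<in> pyr_labels n" for e
  proof (cases e)
    case (Side i s k)
    then show ?thesis using e by (cases s) (auto simp: fragment_def)
  next
    case (Mid i)
    then show ?thesis using e by (auto simp: fragment_def)
  next
    case (Bd i)
    show ?thesis
    proof (cases i)
      case 0
      then show ?thesis using assms Bd by (auto simp: fragment_def)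
    next
      case (Suc j)
      then show ?thesis using e Bd by (auto simp: fragment_def intro!: bexI[of _ j])
    qed
  qed
  moreover have "fragment i \<subseteq> pyr_labels n" if "i < n" for i
    using that by (auto simp: fragment_def)
  ultimately show ?thesis
    by blast
qed

lemma pyrene_edges_eq:
  assumes "n > 0"
  shows "pyrene_edges n = drawn ` pyr_labels n"
proof -
  have "hexagon (4 * int i, 0) \<union> hexagon (4 * int i + 2, 0) \<union> hexagon (4 * int i + 1, 1)
      \<union> hexagon (4 * int i + 1, -1) = drawn ` fragment i" for i
    unfolding hexagon_left hexagon_right hexagon_above hexagon_below image_Un[symmetric] fragment_def UNIV_slot
    by (rule arg_cong[where f = "image drawn"]) auto
  then have "pyrene_edges n = (\<Union>i<n. drawn ` fragment i)"
    unfolding pyrene_edges_def pyrene_corners_def by (simp add: Un_assoc)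
  then show ?thesis
    using UN_fragment[OF assms] by (metis image_UN)
qed

lemma pyrene_verts_eq:
  assumes "n > 0"
  shows "pyrene_verts n = pos ` pyr_nodes n"
proof -
  have "\<Union> (ends ` pyr_labels n) = pyr_nodes n"
  proof
    show "\<Union> (ends ` pyr_labels n) \<subseteq> pyr_nodes n"
    proof
      fix v assume "v \<in> \<Union> (ends ` pyr_labels n)"
      then obtain e where "e \<in> pyr_labels n" "v \<in> ends e" by auto
      then show "v \<in> pyr_nodes n"
        by (cases e rule: ends.cases; auto)
    qed
    have "\<exists>e \<in> pyr_labels n. e \<in> star v" if "v \<in> pyr_nodes n" for v
    proof (cases v)
      case (Core i s c)
      then show ?thesis
        using that by (intro bexI[of _ "Side i s (case c of C1 \<Rightarrow> P1 | C2 \<Rightarrow> S12 | C3 \<Rightarrow> P3)"])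
          (cases c; simp)+
    next
      case (Cap i s c)
      then show ?thesis
        using that by (intro bexI[of _ "Side i s (case c of C1 \<Rightarrow> P1 | C2 \<Rightarrow> T12 | C3 \<Rightarrow> P3)"])
          (cases c; simp)+
    next
      case (Border i s)
      then show ?thesis
        using that by (intro bexI[of _ "Bd i"]) (cases i; simp)+
    qed
    then show "pyr_nodes n \<subseteq> \<Union> (ends ` pyr_labels n)"
      by (auto simp: mem_ends_iff_star)
  qed
  then show ?thesis
    unfolding pyrene_verts_def pyrene_edges_eq[OF assms] drawn_def by (metis image_image image_Union)
qed

definition label_matching :: "nat \<Rightarrow> edge set \<Rightarrow> bool" where
  "label_matching n m \<longleftrightarrow> m \<subseteq> pyr_labels n \<and> (\<forall>v\<in>pyr_nodes n. \<exists>!e. e \<in> m \<and> e \<in> star v)"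

lemma ex1_image_inj:
  assumes "inj f"
  shows "(\<exists>!y. y \<in> f ` A \<and> P y) \<longleftrightarrow> (\<exists>!x. x \<in> A \<and> P (f x))"
proof
  assume "\<exists>!y. y \<in> f ` A \<and> P y"
  then obtain x where x: "x \<in> A" "P (f x)" "\<And>z. z \<in> A \<Longrightarrow> P (f z) \<Longrightarrow> f z = f x"
    by blast
  then have "z = x" if "z \<in> A" "P (f z)" for z
    using that injD[OF assms, of z x] by blast
  then show "\<exists>!x. x \<in> A \<and> P (f x)"
    using x(1,2) by blast
next
  assume "\<exists>!x. x \<in> A \<and> P (f x)"
  then obtain x where x: "x \<in> A" "P (f x)" "\<And>z. z \<in> A \<Longrightarrow> P (f z) \<Longrightarrow> z = x"
    by blast
  show "\<exists>!y. y \<in> f ` A \<and> P y"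
  proof (rule ex1I)
    show "f x \<in> f ` A \<and> P (f x)"
      using x(1,2) by blast
    show "y = f x" if "y \<in> f ` A \<and> P y" for y
      using that x(3) by blast
  qed
qed

lemma perfect_matching_drawn:
  assumes "n > 0" and "F \<subseteq> pyr_labels n"
  shows "perfect_matching (pyrene_verts n) (drawn ` F) (drawn ` m) \<longleftrightarrow> label_matching n m \<and> m \<subseteq> F"
proof -
  have "(\<exists>!e. e \<in> drawn ` m \<and> pos v \<in> e) \<longleftrightarrow> (\<exists>!e. e \<in> m \<and> e \<in> star v)" for v
    by (simp add: ex1_image_inj[OF inj_drawn] pos_mem_drawn_iff)
  then show ?thesis
    unfolding perfect_matching_def label_matching_def pyrene_verts_eq[OF assms(1)]
      inj_image_subset_iff[OF inj_drawn]
    using assms(2) by auto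
qed

section \<open>Perfect matchings as words\<close>

datatype letter = N bool bool | Lf | Rt

fun slots :: "letter \<Rightarrow> bool \<Rightarrow> slot set" where
  "slots (N a b) s = (if (if s then a else b) then {S23, P1, T23} else {S12, P3, T12})"
| "slots Lf s = {S01, T12, P3}"
| "slots Rt s = {S34, T23, P1}"

definition word_matching :: "nat \<Rightarrow> (nat \<Rightarrow> letter) \<Rightarrow> edge set" where
  "word_matching n w =
     {Side i s k | i s k. i < n \<and> k \<in> slots (w i) s} \<union> {Mid i | i. i < n \<and> w i \<in> {Lf, Rt}} \<union>
     {Bd i | i. i \<le> n \<and> \<not> (i < n \<and> w i = Lf) \<and> \<not> (\<exists>j. i = Suc j \<and> w j = Rt)}"

definition valid :: "nat \<Rightarrow> (nat \<Rightarrow> letter) \<Rightarrow> bool" where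
  "valid n w \<longleftrightarrow> (\<forall>i. Suc i < n \<longrightarrow> \<not> (w i = Rt \<and> w (Suc i) = Lf))"

lemma mem_word_matching [simp]:
  "Side i s k \<in> word_matching n w \<longleftrightarrow> i < n \<and> k \<in> slots (w i) s"
  "Mid i \<in> word_matching n w \<longleftrightarrow> i < n \<and> (w i = Lf \<or> w i = Rt)"
  "Bd i \<in> word_matching n w \<longleftrightarrow> i \<le> n \<and> \<not> (i < n \<and> w i = Lf) \<and> \<not> (\<exists>j. i = Suc j \<and> w j = Rt)"
  by (auto simp: word_matching_def)

lemma finite_pyr_labels: "finite (pyr_labels n)"
proof -
  have "e \<in> (\<Union>i<n. fragment i) \<union> Bd ` {..n}" if "e \<in> pyr_labels n" for e
  proof (cases e)
    case (Side i s k)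
    then show ?thesis using that by (cases s) (auto simp: fragment_def)
  qed (use that in \<open>auto simp: fragment_def\<close>)
  moreover have "finite (fragment i)" for i
    by (simp add: fragment_def UNIV_slot)
  ultimately show ?thesis
    by (meson finite_UN_I finite_Un finite_atMost finite_imageI finite_lessThan finite_subset subsetI)
qed

lemma word_matching_subset: "word_matching n w \<subseteq> pyr_labels n"
  by (auto simp: word_matching_def pyr_labels_def)

lemma ex1_mem_three:
  assumes "distinct [a, b, c]"
  shows "(\<exists>!e. e \<in> m \<and> e \<in> {a, b, c}) \<longleftrightarrow>
    (a \<in> m \<and> b \<notin> m \<and> c \<notin> m) \<or> (a \<notin> m \<and> b \<in> m \<and> c \<notin> m) \<or> (a \<notin> m \<and> b \<notin> m \<and> c \<in> m)"
  using assms by auto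

lemma ex1_mem_two:
  assumes "a \<noteq> b"
  shows "(\<exists>!e. e \<in> m \<and> e \<in> {a, b}) \<longleftrightarrow> (a \<in> m \<and> b \<notin> m) \<or> (a \<notin> m \<and> b \<in> m)"
  using assms by auto

lemma ex1_star:
  "(\<exists>!e. e \<in> m \<and> e \<in> star (Core i s C1)) \<longleftrightarrow>
    (Side i s S01 \<in> m \<and> Side i s S12 \<notin> m \<and> Side i s P1 \<notin> m) \<or>
    (Side i s S01 \<notin> m \<and> Side i s S12 \<in> m \<and> Side i s P1 \<notin> m) \<or>
    (Side i s S01 \<notin> m \<and> Side i s S12 \<notin> m \<and> Side i s P1 \<in> m)"
  "(\<exists>!e. e \<in> m \<and> e \<in> star (Core i s C2)) \<longleftrightarrow>
    (Side i s S12 \<in> m \<and> Side i s S23 \<notin> m \<and> Mid i \<notin> m) \<or>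
    (Side i s S12 \<notin> m \<and> Side i s S23 \<in> m \<and> Mid i \<notin> m) \<or>
    (Side i s S12 \<notin> m \<and> Side i s S23 \<notin> m \<and> Mid i \<in> m)"
  "(\<exists>!e. e \<in> m \<and> e \<in> star (Core i s C3)) \<longleftrightarrow>
    (Side i s S23 \<in> m \<and> Side i s S34 \<notin> m \<and> Side i s P3 \<notin> m) \<or>
    (Side i s S23 \<notin> m \<and> Side i s S34 \<in> m \<and> Side i s P3 \<notin> m) \<or>
    (Side i s S23 \<notin> m \<and> Side i s S34 \<notin> m \<and> Side i s P3 \<in> m)"
  "(\<exists>!e. e \<in> m \<and> e \<in> star (Cap i s C1)) \<longleftrightarrow>
    (Side i s P1 \<in> m \<and> Side i s T12 \<notin> m) \<or> (Side i s P1 \<notin> m \<and> Side i s T12 \<in> m)"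
  "(\<exists>!e. e \<in> m \<and> e \<in> star (Cap i s C2)) \<longleftrightarrow>
    (Side i s T12 \<in> m \<and> Side i s T23 \<notin> m) \<or> (Side i s T12 \<notin> m \<and> Side i s T23 \<in> m)"
  "(\<exists>!e. e \<in> m \<and> e \<in> star (Cap i s C3)) \<longleftrightarrow>
    (Side i s T23 \<in> m \<and> Side i s P3 \<notin> m) \<or> (Side i s T23 \<notin> m \<and> Side i s P3 \<in> m)"
  "(\<exists>!e. e \<in> m \<and> e \<in> star (Border 0 s)) \<longleftrightarrow>
    (Bd 0 \<in> m \<and> Side 0 s S01 \<notin> m) \<or> (Bd 0 \<notin> m \<and> Side 0 s S01 \<in> m)"
  "(\<exists>!e. e \<in> m \<and> e \<in> star (Border (Suc i) s)) \<longleftrightarrow>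
    (Bd (Suc i) \<in> m \<and> Side (Suc i) s S01 \<notin> m \<and> Side i s S34 \<notin> m) \<or>
    (Bd (Suc i) \<notin> m \<and> Side (Suc i) s S01 \<in> m \<and> Side i s S34 \<notin> m) \<or>
    (Bd (Suc i) \<notin> m \<and> Side (Suc i) s S01 \<notin> m \<and> Side i s S34 \<in> m)"
  unfolding star.simps by (rule ex1_mem_three ex1_mem_two; simp)+

declare star.simps [simp del]

lemma label_matching_word:
  assumes "valid n w"
  shows "label_matching n (word_matching n w)"
  unfolding label_matching_def
proof (intro conjI ballI)
  fix v assume v: "v \<in> pyr_nodes n"
  show "\<exists>!e. e \<in> word_matching n w \<and> e \<in> star v"
  proof (cases v)
    case (Core i s c)
    then show ?thesis using v by (cases c; cases "w i"; simp add: ex1_star)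
  next
    case (Cap i s c)
    then show ?thesis using v by (cases c; cases "w i"; simp add: ex1_star)
  next
    case (Border i s)
    show ?thesis
    proof (cases i)
      case 0
      then show ?thesis using v Border by (cases "w 0") (auto simp: ex1_star)
    next
      case (Suc j)
      have "\<not> (i < n \<and> w j = Rt \<and> w i = Lf)"
        using assms Suc by (auto simp: valid_def)
      then show ?thesis
        unfolding Border Suc ex1_star using v Border Suc
        by (cases "w i"; cases "w j"; auto)
    qed
  qed
qed (rule word_matching_subset)

lemma word_matching_inject:
  assumes "word_matching n w = word_matching n w'" and "i < n"
  shows "w i = w' i"
proof -
  have "Side i s k \<in> word_matching n w \<longleftrightarrow> Side i s k \<in> word_matching n w'" for s k
    using assms(1) by simp
  then have "k \<in> slots (w i) s \<longleftrightarrow> k \<in> slots (w' i) s" for s k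
    using assms(2) by simp
  from this[of S23 True] this[of S23 False] this[of S01 True] this[of S34 True] show ?thesis
    by (cases "w i"; cases "w' i"; simp split: if_splits)
qed

text \<open>If the two sides of a fragment leave it in opposite directions, then so do those of the
  preceding fragment, which is absurd at the end of the chain.\<close>

lemma label_matching_aligned:
  assumes m: "label_matching n m" and "i < n" and "Mid i \<in> m"
  shows "\<not> (Side i s S01 \<in> m \<and> Side i (\<not> s) S34 \<in> m)"
  using assms(2,3)
proof (induction i)
  case 0
  have "\<exists>!e. e \<in> m \<and> e \<in> star v" if "v \<in> pyr_nodes n" for v
    using m that by (auto simp: label_matching_def)
  note star = this[of "Border 0 s", unfolded ex1_star] this[of "Border 0 (\<not> s)", unfolded ex1_star]
    this[of "Core 0 (\<not> s) C1", unfolded ex1_star] this[of "Core 0 (\<not> s) C3", unfolded ex1_star]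
    this[of "Cap 0 (\<not> s) C1", unfolded ex1_star] this[of "Cap 0 (\<not> s) C2", unfolded ex1_star]
    this[of "Cap 0 (\<not> s) C3", unfolded ex1_star]
  show ?case using star 0 by auto
next
  case (Suc i)
  have covered: "\<exists>!e. e \<in> m \<and> e \<in> star v" if "v \<in> pyr_nodes n" for v
    using m that by (auto simp: label_matching_def)
  note star = covered[of "Border (Suc i) s", unfolded ex1_star]
    covered[of "Border (Suc i) (\<not> s)", unfolded ex1_star]
    covered[of "Core (Suc i) (\<not> s) C1", unfolded ex1_star]
    covered[of "Core (Suc i) (\<not> s) C3", unfolded ex1_star]
    covered[of "Cap (Suc i) (\<not> s) C1", unfolded ex1_star]
    covered[of "Cap (Suc i) (\<not> s) C2", unfolded ex1_star]
    covered[of "Cap (Suc i) (\<not> s) C3", unfolded ex1_star]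
  note prev = covered[of "Core i _ C1", unfolded ex1_star] covered[of "Core i _ C2", unfolded ex1_star]
    covered[of "Core i _ C3", unfolded ex1_star] covered[of "Cap i _ C1", unfolded ex1_star]
    covered[of "Cap i _ C2", unfolded ex1_star] covered[of "Cap i _ C3", unfolded ex1_star]
  show ?case
  proof
    assume *: "Side (Suc i) s S01 \<in> m \<and> Side (Suc i) (\<not> s) S34 \<in> m"
    then have out: "Side i (\<not> s) S34 \<in> m" "Side i s S34 \<notin> m"
      using star Suc.prems by auto
    then have "Mid i \<in> m"
      using prev[of "\<not> s"] Suc.prems by auto
    then have "Side i s S01 \<in> m"
      using prev[of s] Suc.prems out by auto
    then show False
      using Suc out \<open>Mid i \<in> m\<close> by simp
  qed
qed

definition word_of :: "edge set \<Rightarrow> nat \<Rightarrow> letter" where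
  "word_of m i = (if Mid i \<in> m then (if Side i True S01 \<in> m then Lf else Rt)
     else N (Side i True S23 \<in> m) (Side i False S23 \<in> m))"

lemma label_matching_side:
  assumes m: "label_matching n m" and i: "i < n"
  obtains c where "\<And>k. Side i s k \<in> m \<longleftrightarrow> k \<in> slots c s" "Mid i \<in> m \<longleftrightarrow> c = Lf \<or> c = Rt"
proof -
  have "\<exists>!e. e \<in> m \<and> e \<in> star v" if "v \<in> pyr_nodes n" for v
    using m that by (auto simp: label_matching_def)
  note star = this[of "Core i s C1"] this[of "Core i s C2"] this[of "Core i s C3"]
    this[of "Cap i s C1"] this[of "Cap i s C2"] this[of "Cap i s C3"]
  define c where "c = (if Side i s S01 \<in> m then Lf else if Side i s S34 \<in> m then Rt
      else N (Side i s S23 \<in> m) (Side i s S23 \<in> m))"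
  have "Side i s k \<in> m \<longleftrightarrow> k \<in> slots c s" for k
    using star i unfolding ex1_star c_def
    by (cases "Side i s P1 \<in> m"; cases "Mid i \<in> m"; cases k; auto)
  moreover have "Mid i \<in> m \<longleftrightarrow> c = Lf \<or> c = Rt"
    using star i unfolding ex1_star c_def by auto
  ultimately show ?thesis
    by (rule that)
qed

lemma label_matching_slots:
  assumes m: "label_matching n m" and i: "i < n"
  shows "Side i s k \<in> m \<longleftrightarrow> k \<in> slots (word_of m i) s"
proof -
  obtain c where c: "\<And>k. Side i True k \<in> m \<longleftrightarrow> k \<in> slots c True" "Mid i \<in> m \<longleftrightarrow> c = Lf \<or> c = Rt"
    using label_matching_side[OF m i] by blast
  obtain d where d: "\<And>k. Side i False k \<in> m \<longleftrightarrow> k \<in> slots d False" "Mid i \<in> m \<longleftrightarrow> d = Lf \<or> d = Rt"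
    using label_matching_side[OF m i] by blast
  have "slots (word_of m i) True = slots c True \<and> slots (word_of m i) False = slots d False"
  proof (cases "Mid i \<in> m")
    case True
    have "c = d"
      using label_matching_aligned[OF m i True, of True] label_matching_aligned[OF m i True, of False]
        c d True by auto
    moreover have "word_of m i = c"
      using True c(2) c(1)[of S01] by (auto simp: word_of_def)
    ultimately show ?thesis by simp
  next
    case False
    then obtain a b a' b' where "c = N a b" "d = N a' b'"
      using c(2) d(2) by (metis letter.exhaust)
    then have "word_of m i = N a b'"
      using False c(1)[of S23] d(1)[of S23] by (simp add: word_of_def)
    then show ?thesis
      using \<open>c = N a b\<close> \<open>d = N a' b'\<close> by simp
  qed
  then show ?thesis
    using c(1) d(1) by (cases s) simp_all
qed

lemma label_matching_imp_word:
  assumes m: "label_matching n m" and n: "n > 0"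
  shows "m = word_matching n (word_of m)" "valid n (word_of m)"
proof -
  have *: "\<exists>!e. e \<in> m \<and> e \<in> star v" if "v \<in> pyr_nodes n" for v
    using m that by (auto simp: label_matching_def)
  have sub: "m \<subseteq> pyr_labels n"
    using m by (simp add: label_matching_def)
  have S01: "Side i s S01 \<in> m \<longleftrightarrow> i < n \<and> word_of m i = Lf" for i s
    using label_matching_slots[OF m, of i s S01] sub
    by (cases "i < n"; cases "word_of m i"; auto)
  have S34: "Side i s S34 \<in> m \<longleftrightarrow> i < n \<and> word_of m i = Rt" for i s
    using label_matching_slots[OF m, of i s S34] sub
    by (cases "i < n"; cases "word_of m i"; auto)
  have "e \<in> m \<longleftrightarrow> e \<in> word_matching n (word_of m)" for e
  proof (cases e)
    case (Side i s k)
    then show ?thesis using label_matching_slots[OF m, of i s k] sub by auto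
  next
    case (Mid i)
    then show ?thesis using sub by (auto simp: word_of_def)
  next
    case (Bd i)
    show ?thesis
    proof (cases "i \<le> n")
      case True
      then show ?thesis
        using *[of "Border i True"] Bd n by (cases i; auto simp: ex1_star S01 S34)
    next
      case False
      then show ?thesis using sub Bd by auto
    qed
  qed
  then show "m = word_matching n (word_of m)" by blast
  show "valid n (word_of m)"
    unfolding valid_def
  proof (intro allI impI)
    fix i assume "Suc i < n"
    then show "\<not> (word_of m i = Rt \<and> word_of m (Suc i) = Lf)"
      using *[of "Border (Suc i) True"] by (auto simp: ex1_star S01 S34)
  qed
qed

section \<open>The anti-forcing number of a word\<close>

fun weight :: "letter \<Rightarrow> nat" where
  "weight (N a b) = (if a = b then 3 else 2)" | "weight Lf = 1" | "weight Rt = 1"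

definition word_forcing :: "nat \<Rightarrow> (nat \<Rightarrow> letter) \<Rightarrow> edge set \<Rightarrow> bool" where
  "word_forcing n w T \<longleftrightarrow> T \<subseteq> pyr_labels n - word_matching n w \<and>
     (\<forall>w'. valid n w' \<longrightarrow> word_matching n w' \<inter> T = {} \<longrightarrow> word_matching n w' = word_matching n w)"

lemma perfect_matching_word:
  assumes n: "n > 0"
  shows "perfect_matching (pyrene_verts n) (drawn ` (pyr_labels n - T)) M \<longleftrightarrow>
    (\<exists>w. M = drawn ` word_matching n w \<and> valid n w \<and> word_matching n w \<inter> T = {})"
    (is "?pm M \<longleftrightarrow> ?word M")
proof
  assume M: "?pm M"
  then have "M \<subseteq> drawn ` (pyr_labels n - T)"
    by (simp add: perfect_matching_def)
  then obtain m where m: "M = drawn ` m"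
    by (metis subset_imageE)
  then have "label_matching n m" "m \<subseteq> pyr_labels n - T"
    using M perfect_matching_drawn[OF n, of "pyr_labels n - T" m] by auto
  then show "?word M"
    using label_matching_imp_word[OF _ n, of m] m by blast
next
  assume "?word M"
  then obtain w where w: "M = drawn ` word_matching n w" "valid n w" "word_matching n w \<inter> T = {}"
    by blast
  then have "word_matching n w \<subseteq> pyr_labels n - T"
    using word_matching_subset[of n w] by blast
  then show "?pm M"
    using perfect_matching_drawn[OF n, of "pyr_labels n - T" "word_matching n w"]
      label_matching_word[OF w(2)] w(1) by auto
qed

lemma anti_forcing_set_drawn:
  assumes n: "n > 0" and w: "valid n w"
  shows "anti_forcing_set (pyrene_verts n) (pyrene_edges n) (drawn ` word_matching n w) (drawn ` T)
    \<longleftrightarrow> word_forcing n w T"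
proof -
  have diff: "pyrene_edges n - drawn ` T = drawn ` (pyr_labels n - T)"
    by (simp add: pyrene_edges_eq[OF n] image_set_diff[OF inj_drawn])
  have sub: "drawn ` T \<subseteq> pyrene_edges n - drawn ` word_matching n w \<longleftrightarrow> T \<subseteq> pyr_labels n - word_matching n w"
    unfolding pyrene_edges_eq[OF n] image_set_diff[OF inj_drawn, symmetric]
    by (rule inj_image_subset_iff[OF inj_drawn])
  have pm: "perfect_matching (pyrene_verts n) (drawn ` (pyr_labels n - T)) (drawn ` word_matching n w)"
    if "T \<subseteq> pyr_labels n - word_matching n w"
    using that w by (subst perfect_matching_word[OF n]) blast
  have "(\<forall>M'. perfect_matching (pyrene_verts n) (drawn ` (pyr_labels n - T)) M'
      \<longrightarrow> M' = drawn ` word_matching n w) \<longleftrightarrow>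
    (\<forall>w'. valid n w' \<longrightarrow> word_matching n w' \<inter> T = {} \<longrightarrow>
      drawn ` word_matching n w' = drawn ` word_matching n w)"
    unfolding perfect_matching_word[OF n] by metis
  then show ?thesis
    unfolding anti_forcing_set_def word_forcing_def diff sub inj_image_eq_iff[OF inj_drawn]
    using pm by metis
qed

fun cut :: "nat \<Rightarrow> letter \<Rightarrow> edge set" where
  "cut i (N a b) = {Side i True (if a then P3 else P1), Side i False (if b then P3 else P1)}
     \<union> (if a = b then {Mid i} else {})"
| "cut i Lf = {Bd i}"
| "cut i Rt = {Bd (Suc i)}"

lemma card_cut_le: "card (cut i c) \<le> weight c"
  by (cases c) (auto simp: card_insert_if)

lemma word_forcing_cut:
  assumes w: "valid n w"
  shows "word_forcing n w (\<Union>i<n. cut i (w i))"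
proof -
  have "cut i (w i) \<subseteq> pyr_labels n - word_matching n w" if "i < n" for i
    using that by (cases "w i") auto
  moreover have "word_matching n w' = word_matching n w"
    if "word_matching n w' \<inter> (\<Union>i<n. cut i (w i)) = {}" for w'
  proof -
    have cut: "e \<notin> word_matching n w'" if "i < n" "e \<in> cut i (w i)" for e i
      using that \<open>word_matching n w' \<inter> _ = {}\<close> by auto
    have N: "w' i = N a b" if "i < n" "w i = N a b" for i a b
    proof -
      have "Side i True (if a then P3 else P1) \<notin> word_matching n w'"
        "Side i False (if b then P3 else P1) \<notin> word_matching n w'"
        "a = b \<Longrightarrow> Mid i \<notin> word_matching n w'"
        by (rule cut[OF that(1)]; simp add: that(2))+
      then show ?thesis
        using that by (cases "w' i"; auto split: if_splits)
    qed
    have L: "i < n \<Longrightarrow> w i = Lf \<Longrightarrow> w' i = Lf" for i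
    proof (induction i)
      case 0
      then show ?case using cut[of 0 "Bd 0"] by auto
    next
      case (Suc i)
      then have "w' (Suc i) = Lf \<or> w' i = Rt"
        using cut[of "Suc i" "Bd (Suc i)"] by auto
      moreover have "w i \<noteq> Rt"
        using w Suc by (auto simp: valid_def)
      ultimately show ?case
        using N[of i] Suc by (cases "w i"; auto)
    qed
    have R: "i < n \<Longrightarrow> w i = Rt \<Longrightarrow> w' i = Rt" for i
    proof (induction "n - i" arbitrary: i)
      case (Suc k)
      then have *: "w' i = Rt \<or> Suc i < n \<and> w' (Suc i) = Lf"
        using cut[of i "Bd (Suc i)"] by auto
      show ?case
      proof (rule ccontr)
        assume "w' i \<noteq> Rt"
        then have i: "Suc i < n" "w' (Suc i) = Lf" using * by auto
        then have "w (Suc i) \<noteq> Lf"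
          using w Suc by (auto simp: valid_def)
        moreover have "k = n - Suc i"
          using Suc(2) by simp
        ultimately show False
          using N[of "Suc i"] Suc(1)[of "Suc i"] i by (cases "w (Suc i)"; auto)
      qed
    qed simp
    have "w' i = w i" if "i < n" for i
      using that N L R by (cases "w i") auto
    then show ?thesis
      by (auto simp: word_matching_def)
  qed
  ultimately show ?thesis
    unfolding word_forcing_def by blast
qed

text \<open>Index \<open>(i, q)\<close> stands for the \<open>q\<close>-th rival of the \<open>i\<close>-th letter; an edge that some rival adds
  to the matching is sent to the index of that rival.\<close>

fun charge :: "nat \<Rightarrow> (nat \<Rightarrow> letter) \<Rightarrow> edge \<Rightarrow> nat \<times> nat" where
  "charge n w (Side i s k) = (case w i of
       N a b \<Rightarrow> (i, if k = S01 \<or> k = S34 then 2 else if s then 1 else 0)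
     | Lf \<Rightarrow> if k = S12 then (i, 0) else (GREATEST j. j \<le> i \<and> w j \<noteq> Lf, 2)
     | Rt \<Rightarrow> if k = S23 then (i, 0) else (LEAST j. i \<le> j \<and> w j \<noteq> Rt, 2))"
| "charge n w (Mid i) = (i, 2)"
| "charge n w (Bd i) = (if i < n \<and> w i = Lf then i else i - 1, 0)"

lemma rival_word_flip:
  assumes w: "valid n w" and i: "i < n" "w i = N a b" and q: "q < 2"
  obtains w' where "valid n w'" "w' i \<noteq> w i"
    "\<And>e. e \<in> word_matching n w' - word_matching n w \<Longrightarrow> charge n w e = (i, q)"
proof (rule that)
  define c where "c = (if q = 0 then N a (\<not> b) else N (\<not> a) b)"
  define w' where "w' = w(i := c)"
  have w'_eq: "w' j = Lf \<longleftrightarrow> w j = Lf" "w' j = Rt \<longleftrightarrow> w j = Rt" for j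
    using i by (auto simp: w'_def c_def)
  show "valid n w'"
    using w by (simp add: valid_def w'_eq)
  show "w' i \<noteq> w i"
    using i by (simp add: w'_def c_def)
  show "charge n w e = (i, q)" if e: "e \<in> word_matching n w' - word_matching n w" for e
  proof (cases e)
    case (Side j s k)
    then have *: "k \<in> slots (w' j) s" "k \<notin> slots (w j) s"
      using e by auto
    then have "j = i"
      by (auto simp: w'_def split: if_splits)
    with * have "k \<in> slots c s" "k \<notin> slots (N a b) s"
      using i by (simp_all add: w'_def)
    then show ?thesis
      using Side i q \<open>j = i\<close> by (cases s; cases k; cases a; cases b; cases "q = 0"; simp add: c_def)
  qed (use e in \<open>auto simp: w'_eq\<close>)
qed

lemma rival_word_Lf:
  assumes w: "valid n w" and i: "i < n" "w i = Lf"
  obtains w' where "valid n w'" "w' i \<noteq> w i"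
    "\<And>e. e \<in> word_matching n w' - word_matching n w \<Longrightarrow> charge n w e = (i, 0)"
proof (rule that)
  define w' where "w' = w(i := N False False)"
  have w'_eq: "w' j = Lf \<longleftrightarrow> j \<noteq> i \<and> w j = Lf" "w' j = Rt \<longleftrightarrow> w j = Rt" for j
    using i by (auto simp: w'_def)
  show "valid n w'"
    using w by (simp add: valid_def w'_eq)
  show "w' i \<noteq> w i"
    using i by (simp add: w'_def)
  show "charge n w e = (i, 0)" if e: "e \<in> word_matching n w' - word_matching n w" for e
  proof (cases e)
    case (Side j s k)
    then have *: "k \<in> slots (w' j) s" "k \<notin> slots (w j) s"
      using e by auto
    then have "j = i"
      by (auto simp: w'_def split: if_splits)
    then show ?thesis
      using Side i * by (auto simp: w'_def)
  next
    case (Mid j)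
    then show ?thesis
      using e by (auto simp: w'_eq)
  next
    case (Bd j)
    then have "j = i"
      using e by (simp add: w'_eq) blast
    then show ?thesis
      using Bd i by simp
  qed
qed

lemma rival_word_Rt:
  assumes w: "valid n w" and i: "i < n" "w i = Rt"
  obtains w' where "valid n w'" "w' i \<noteq> w i"
    "\<And>e. e \<in> word_matching n w' - word_matching n w \<Longrightarrow> charge n w e = (i, 0)"
proof (rule that)
  define w' where "w' = w(i := N True True)"
  have w'_eq: "w' j = Rt \<longleftrightarrow> j \<noteq> i \<and> w j = Rt" "w' j = Lf \<longleftrightarrow> w j = Lf" for j
    using i by (auto simp: w'_def)
  show "valid n w'"
    using w by (simp add: valid_def w'_eq)
  show "w' i \<noteq> w i"
    using i by (simp add: w'_def)
  show "charge n w e = (i, 0)" if e: "e \<in> word_matching n w' - word_matching n w" for e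
  proof (cases e)
    case (Side j s k)
    then have *: "k \<in> slots (w' j) s" "k \<notin> slots (w j) s"
      using e by auto
    then have "j = i"
      by (auto simp: w'_def split: if_splits)
    then show ?thesis
      using Side i * by (auto simp: w'_def)
  next
    case (Mid j)
    then show ?thesis
      using e by (auto simp: w'_eq)
  next
    case (Bd j)
    then have "j = Suc i"
      using e by (simp add: w'_eq) blast
    then show ?thesis
      using Bd i w by (simp add: valid_def)
  qed
qed

text \<open>The rival turns \<open>Rt\<dots>Rt (N False False)\<close> into \<open>Lf\<dots>Lf\<close>: the inner hexagon of \<open>N False False\<close>
  alone cannot be rotated when its border edge is unmatched, so the run is rotated with it.\<close>

lemma rival_word_left_run:
  assumes w: "valid n w" and i: "i < n" "w i = N False False"
  obtains w' where "valid n w'" "w' i \<noteq> w i"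
    "\<And>e. e \<in> word_matching n w' - word_matching n w \<Longrightarrow> charge n w e = (i, 2)"
proof (rule that)
  define run where "run = {j. j \<le> i \<and> (\<forall>t. j \<le> t \<and> t < i \<longrightarrow> w t = Rt)}"
  define w' where "w' = (\<lambda>j. if j \<in> run then Lf else w j)"
  have run_Suc: "Suc j \<in> run" if "j \<in> run" "j \<noteq> i" for j
    using that by (auto simp: run_def)
  have run_pred: "j \<in> run" if "Suc j \<in> run" "w j = Rt" for j
  proof -
    have "w t = Rt" if "j \<le> t" "t < i" for t
      using \<open>Suc j \<in> run\<close> \<open>w j = Rt\<close> that by (cases "t = j") (auto simp: run_def)
    then show ?thesis
      using that(1) by (auto simp: run_def)
  qed
  have run_i: "i \<in> run"
    by (auto simp: run_def)
  have run_Rt: "w j = Rt" if "j \<in> run" "j \<noteq> i" for j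
    using that by (auto simp: run_def)
  have run_le: "j \<le> i" if "j \<in> run" for j
    using that by (auto simp: run_def)
  have target: "(LEAST t. j \<le> t \<and> w t \<noteq> Rt) = i" if "j \<in> run" for j
  proof (rule Least_equality)
    show "j \<le> i \<and> w i \<noteq> Rt"
      using that i by (simp add: run_def)
    show "i \<le> t" if t: "j \<le> t \<and> w t \<noteq> Rt" for t
    proof (rule ccontr)
      assume "\<not> i \<le> t"
      then have "w t = Rt"
        using \<open>j \<in> run\<close> t by (simp add: run_def)
      then show False
        using t by simp
    qed
  qed
  show "valid n w'"
    unfolding valid_def
  proof (intro allI impI notI)
    fix j assume j: "Suc j < n" "w' j = Rt \<and> w' (Suc j) = Lf"
    then have "j \<notin> run" "w j = Rt"
      by (auto simp: w'_def split: if_splits)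
    then have "w' (Suc j) = w (Suc j)"
      using run_pred[of j] by (auto simp: w'_def)
    then show False
      using w j \<open>w j = Rt\<close> by (auto simp: valid_def)
  qed
  show "w' i \<noteq> w i"
    using i run_i by (simp add: w'_def)
  show "charge n w e = (i, 2)" if e: "e \<in> word_matching n w' - word_matching n w" for e
  proof (cases e)
    case (Side j s k)
    then have "j \<in> run"
      using e by (auto simp: w'_def split: if_splits)
    then show ?thesis
      using e Side i run_Rt[of j] target[of j] by (cases "j = i") (auto simp: w'_def)
  next
    case (Mid j)
    then have "j \<in> run"
      using e by (auto simp: w'_def split: if_splits)
    then show ?thesis
      using e Mid run_Rt[of j] by (cases "j = i") auto
  next
    case (Bd j)
    then have *: "j \<le> n" "\<not> (j < n \<and> w' j = Lf)" "\<And>t. j = Suc t \<Longrightarrow> w' t \<noteq> Rt"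
      using e by auto
    then have "\<not> (j < n \<and> w j = Lf)"
      by (auto simp: w'_def split: if_splits)
    then obtain t where t: "j = Suc t" "w t = Rt"
      using e Bd * by auto
    then have "t \<in> run" "t \<noteq> i"
      using *(3)[of t] i by (auto simp: w'_def split: if_splits)
    then have "Suc t \<in> run"
      by (rule run_Suc)
    then show ?thesis
      using *(2) t i run_le[of j] by (auto simp: w'_def)
  qed
qed

lemma rival_word_right_run:
  assumes w: "valid n w" and i: "i < n" "w i = N True True"
  obtains w' where "valid n w'" "w' i \<noteq> w i"
    "\<And>e. e \<in> word_matching n w' - word_matching n w \<Longrightarrow> charge n w e = (i, 2)"
proof (rule that)
  define run where "run = {j. i \<le> j \<and> (\<forall>t. i < t \<and> t \<le> j \<longrightarrow> w t = Lf)}"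
  define w' where "w' = (\<lambda>j. if j \<in> run then Rt else w j)"
  have run_pred: "j \<in> run" if "Suc j \<in> run" "Suc j \<noteq> i" for j
    using that by (auto simp: run_def)
  have run_Suc: "Suc j \<in> run" if "j \<in> run" "w (Suc j) = Lf" for j
    using that unfolding run_def by (auto simp: le_Suc_eq)
  have run_i: "i \<in> run"
    by (auto simp: run_def)
  have run_Lf: "w j = Lf" if "j \<in> run" "j \<noteq> i" for j
    using that by (auto simp: run_def)
  have target: "(GREATEST t. t \<le> j \<and> w t \<noteq> Lf) = i" if "j \<in> run" for j
  proof (rule Greatest_equality)
    show "i \<le> j \<and> w i \<noteq> Lf"
      using that i by (simp add: run_def)
    show "t \<le> i" if t: "t \<le> j \<and> w t \<noteq> Lf" for t
    proof (rule ccontr)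
      assume "\<not> t \<le> i"
      then have "w t = Lf"
        using \<open>j \<in> run\<close> t by (simp add: run_def)
      then show False
        using t by simp
    qed
  qed
  show "valid n w'"
    unfolding valid_def
  proof (intro allI impI notI)
    fix j assume j: "Suc j < n" "w' j = Rt \<and> w' (Suc j) = Lf"
    then have "Suc j \<notin> run" "w (Suc j) = Lf"
      by (auto simp: w'_def split: if_splits)
    then have "w' j = w j"
      using run_Suc[of j] by (auto simp: w'_def)
    then show False
      using w j \<open>w (Suc j) = Lf\<close> by (auto simp: valid_def)
  qed
  show "w' i \<noteq> w i"
    using i run_i by (simp add: w'_def)
  show "charge n w e = (i, 2)" if e: "e \<in> word_matching n w' - word_matching n w" for e
  proof (cases e)
    case (Side j s k)
    then have "j \<in> run"
      using e by (auto simp: w'_def split: if_splits)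
    then show ?thesis
      using e Side i run_Lf[of j] target[of j] by (cases "j = i") (auto simp: w'_def)
  next
    case (Mid j)
    then have "j \<in> run"
      using e by (auto simp: w'_def split: if_splits)
    then show ?thesis
      using e Mid run_Lf[of j] by (cases "j = i") auto
  next
    case (Bd j)
    then have *: "j \<le> n" "\<not> (j < n \<and> w' j = Lf)" "\<And>t. j = Suc t \<Longrightarrow> w' t \<noteq> Rt"
      using e by auto
    then have "w t \<noteq> Rt" if "j = Suc t" for t
      using that by (auto simp: w'_def split: if_splits)
    then have j: "j < n" "w j = Lf"
      using e Bd * by auto
    then have "j \<in> run" "j \<noteq> i"
      using *(2) i by (auto simp: w'_def split: if_splits)
    then obtain t where "j = Suc t" "t \<in> run"
      using run_pred[of "j - 1"] run_def by (cases j) auto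
    then show ?thesis
      using *(3) by (auto simp: w'_def)
  qed
qed

lemma rival_word:
  assumes w: "valid n w" and i: "i < n" and q: "q < weight (w i)"
  obtains w' where "valid n w'" "word_matching n w' \<noteq> word_matching n w"
    "\<And>e. e \<in> word_matching n w' - word_matching n w \<Longrightarrow> charge n w e = (i, q)"
proof -
  obtain w' where "valid n w'" "w' i \<noteq> w i"
    "\<And>e. e \<in> word_matching n w' - word_matching n w \<Longrightarrow> charge n w e = (i, q)"
  proof (cases "w i")
    case (N a b)
    show ?thesis
    proof (cases "q < 2")
      case True
      then show ?thesis using rival_word_flip[OF w i N] that by blast
    next
      case False
      then have "q = 2" "a = b"
        using q N by (auto split: if_splits)
      show ?thesis
      proof (cases a)
        case True
        then have run: "w i = N True True"
          using N \<open>a = b\<close> by simp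
        show ?thesis
          by (rule rival_word_right_run[OF w i run]) (rule that[unfolded \<open>q = 2\<close>])
      next
        case False
        then have run: "w i = N False False"
          using N \<open>a = b\<close> by simp
        show ?thesis
          by (rule rival_word_left_run[OF w i run]) (rule that[unfolded \<open>q = 2\<close>])
      qed
    qed
  next
    case Lf
    then have "q = 0"
      using q by simp
    show ?thesis
      by (rule rival_word_Lf[OF w i Lf]) (rule that[unfolded \<open>q = 0\<close>])
  next
    case Rt
    then have "q = 0"
      using q by simp
    show ?thesis
      by (rule rival_word_Rt[OF w i Rt]) (rule that[unfolded \<open>q = 0\<close>])
  qed
  then show ?thesis
    using that word_matching_inject[OF _ i] by metis
qed

lemma weight_le_card_word_forcing:
  assumes w: "valid n w" and T: "word_forcing n w T"
  shows "(\<Sum>i<n. weight (w i)) \<le> card T"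
proof -
  let ?I = "SIGMA i:{..<n}. {..<weight (w i)}"
  have "?I \<subseteq> charge n w ` T"
  proof
    fix x assume "x \<in> ?I"
    then obtain i q where x: "x = (i, q)" "i < n" "q < weight (w i)" by auto
    obtain w' where w': "valid n w'" "word_matching n w' \<noteq> word_matching n w"
      "\<And>e. e \<in> word_matching n w' - word_matching n w \<Longrightarrow> charge n w e = (i, q)"
      using rival_word[OF w x(2,3)] by blast
    then obtain e where "e \<in> word_matching n w'" "e \<in> T"
      using T unfolding word_forcing_def by blast
    moreover have "e \<notin> word_matching n w"
      using T \<open>e \<in> T\<close> unfolding word_forcing_def by blast
    ultimately show "x \<in> charge n w ` T"
      using w'(3)[of e] x(1) by (metis DiffI imageI)
  qed
  moreover have "finite T"
    using T finite_pyr_labels[of n] unfolding word_forcing_def by (meson Diff_subset finite_subset)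
  ultimately have "card ?I \<le> card T"
    by (meson card_image_le card_mono finite_imageI le_trans)
  then show ?thesis
    by simp
qed

lemma af_word:
  assumes n: "n > 0" and w: "valid n w"
  shows "af (pyrene_verts n) (pyrene_edges n) (drawn ` word_matching n w) = (\<Sum>i<n. weight (w i))"
proof -
  let ?S = "{S. anti_forcing_set (pyrene_verts n) (pyrene_edges n) (drawn ` word_matching n w) S}"
  let ?T = "\<Union>i<n. cut i (w i)"
  have ge: "(\<Sum>i<n. weight (w i)) \<le> card S" if "S \<in> ?S" for S
  proof -
    have "S \<subseteq> drawn ` pyr_labels n"
      using that unfolding anti_forcing_set_def pyrene_edges_eq[OF n] by blast
    then obtain T where T: "S = drawn ` T"
      by (metis subset_imageE)
    then have "word_forcing n w T"
      using that anti_forcing_set_drawn[OF n w] by simp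
    then show ?thesis
      using weight_le_card_word_forcing[OF w] card_image[OF inj_on_subset[OF inj_drawn subset_UNIV]] T
      by metis
  qed
  have "drawn ` ?T \<in> ?S"
    using anti_forcing_set_drawn[OF n w] word_forcing_cut[OF w] by blast
  moreover have "card (drawn ` ?T) \<le> (\<Sum>i<n. weight (w i))"
  proof -
    have "card (drawn ` ?T) = card ?T"
      by (rule card_image[OF inj_on_subset[OF inj_drawn subset_UNIV]])
    also have "\<dots> \<le> (\<Sum>i<n. card (cut i (w i)))"
      by (rule card_UN_le) simp
    also have "\<dots> \<le> (\<Sum>i<n. weight (w i))"
      by (rule sum_mono) (rule card_cut_le)
    finally show ?thesis .
  qed
  ultimately have "card (drawn ` ?T) = (\<Sum>i<n. weight (w i))"
    using ge by (simp add: le_antisym)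
  then have mem: "(\<Sum>i<n. weight (w i)) \<in> card ` ?S"
    using \<open>drawn ` ?T \<in> ?S\<close> by (rule image_eqI[OF sym])
  have "?S \<subseteq> Pow (drawn ` pyr_labels n)"
    unfolding anti_forcing_set_def pyrene_edges_eq[OF n] by blast
  then have "finite ?S"
    using finite_pyr_labels[of n] by (simp add: finite_subset)
  then show ?thesis
    unfolding af_def using ge mem by (intro Min_eqI) blast+
qed

section \<open>Counting words\<close>

definition words :: "nat \<Rightarrow> letter list set" where
  "words n = {xs. length xs = n \<and> valid n (nth xs)}"

definition words_after_Rt :: "nat \<Rightarrow> letter list set" where
  "words_after_Rt n = {xs \<in> words n. \<not> (n > 0 \<and> xs ! 0 = Lf)}"

lemma word_matching_cong:
  assumes "\<And>i. i < n \<Longrightarrow> w i = w' i"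
  shows "word_matching n w = word_matching n w'"
proof -
  have "e \<in> word_matching n w \<longleftrightarrow> e \<in> word_matching n w'" for e
    using assms by (cases e) (auto simp: Suc_le_eq)
  then show ?thesis by blast
qed

lemma perfect_matchings_eq_words:
  assumes n: "n > 0"
  shows "{M. perfect_matching (pyrene_verts n) (pyrene_edges n) M} =
    (\<lambda>xs. drawn ` word_matching n (nth xs)) ` words n"
proof -
  have pm: "perfect_matching (pyrene_verts n) (pyrene_edges n) M \<longleftrightarrow>
      (\<exists>w. M = drawn ` word_matching n w \<and> valid n w)" for M
    using perfect_matching_word[OF n, of "{}" M] by (simp add: pyrene_edges_eq[OF n])
  have "\<exists>xs\<in>words n. word_matching n w = word_matching n (nth xs)" if "valid n w" for w
  proof
    show "map w [0..<n] \<in> words n"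
      using that by (simp add: words_def valid_def)
    show "word_matching n w = word_matching n (nth (map w [0..<n]))"
      by (rule word_matching_cong) simp
  qed
  then have "{M. perfect_matching (pyrene_verts n) (pyrene_edges n) M} \<subseteq>
      (\<lambda>xs. drawn ` word_matching n (nth xs)) ` words n"
    unfolding pm by fast
  moreover have "(\<lambda>xs. drawn ` word_matching n (nth xs)) ` words n \<subseteq>
      {M. perfect_matching (pyrene_verts n) (pyrene_edges n) M}"
    unfolding pm words_def by blast
  ultimately show ?thesis
    by (rule subset_antisym)
qed

lemma inj_on_word_matching: "inj_on (\<lambda>xs. drawn ` word_matching n (nth xs)) (words n)"
proof (rule inj_onI)
  fix xs ys
  assume "xs \<in> words n" "ys \<in> words n"
    and "drawn ` word_matching n (nth xs) = drawn ` word_matching n (nth ys)"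
  then show "xs = ys"
    using word_matching_inject[of n "nth xs" "nth ys"]
    by (intro nth_equalityI) (simp_all add: words_def inj_image_eq_iff[OF inj_drawn])
qed

lemma pyrene_Phi_eq: "n > 0 \<Longrightarrow> pyrene_Phi n = card (words n)"
  unfolding pyrene_Phi_def perfect_matchings_eq_words by (rule card_image[OF inj_on_word_matching])

lemma pyrene_AF_eq:
  assumes n: "n > 0"
  shows "pyrene_AF n = (\<Sum>xs\<in>words n. \<Sum>x\<leftarrow>xs. weight x)"
proof -
  have "pyrene_AF n = (\<Sum>xs\<in>words n. af (pyrene_verts n) (pyrene_edges n) (drawn ` word_matching n (nth xs)))"
    unfolding pyrene_AF_def perfect_matchings_eq_words[OF n]
    by (simp add: sum.reindex[OF inj_on_word_matching])
  also have "\<dots> = (\<Sum>xs\<in>words n. \<Sum>x\<leftarrow>xs. weight x)"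
  proof (rule sum.cong)
    fix xs assume "xs \<in> words n"
    then show "af (pyrene_verts n) (pyrene_edges n) (drawn ` word_matching n (nth xs)) = (\<Sum>x\<leftarrow>xs. weight x)"
      by (simp add: af_word[OF n] words_def sum_list_sum_nth atLeast0LessThan)
  qed simp
  finally show ?thesis .
qed

lemma valid_Cons:
  "valid (Suc n) (nth (c # xs)) \<longleftrightarrow> valid n (nth xs) \<and> \<not> (n > 0 \<and> c = Rt \<and> xs ! 0 = Lf)"
proof -
  have "(\<forall>i. P i) \<longleftrightarrow> P 0 \<and> (\<forall>i. P (Suc i))" for P :: "nat \<Rightarrow> bool"
    by (metis not0_implies_Suc)
  from this[of "\<lambda>i. Suc i < Suc n \<longrightarrow> \<not> ((c # xs) ! i = Rt \<and> (c # xs) ! Suc i = Lf)"] show ?thesis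
    unfolding valid_def by auto
qed

definition tails :: "nat \<Rightarrow> letter \<Rightarrow> letter list set" where
  "tails n c = (if c = Rt then words_after_Rt n else words n)"

lemma Cons_mem_words:
  "c # xs \<in> words (Suc n) \<longleftrightarrow> xs \<in> tails n c"
  by (auto simp: tails_def words_def words_after_Rt_def valid_Cons)

lemma UNIV_letter: "UNIV = {N False False, N False True, N True False, N True True, Lf, Rt}"
proof -
  have "c \<in> {N False False, N False True, N True False, N True True, Lf, Rt}" for c
    by (cases c) auto
  then show ?thesis by blast
qed

lemma words_Suc:
  "words (Suc n) = (\<Union>c. (#) c ` tails n c)"
  "words_after_Rt (Suc n) = (\<Union>c\<in>-{Lf}. (#) c ` tails n c)"
proof -
  have "xs \<in> words (Suc n) \<longleftrightarrow> (\<exists>c ys. xs = c # ys \<and> ys \<in> tails n c)" for xs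
  proof (cases xs)
    case Nil
    then show ?thesis by (simp add: words_def)
  qed (simp add: Cons_mem_words)
  then show *: "words (Suc n) = (\<Union>c. (#) c ` tails n c)"
    by blast
  show "words_after_Rt (Suc n) = (\<Union>c\<in>-{Lf}. (#) c ` tails n c)"
    unfolding words_after_Rt_def[of "Suc n"] * by auto
qed

lemma finite_words: "finite (words n)" "finite (words_after_Rt n)"
proof -
  have "finite (UNIV :: letter set)"
    by (simp add: UNIV_letter)
  from finite_lists_length_eq[OF this, of n] show "finite (words n)"
    by (rule finite_subset[rotated]) (auto simp: words_def)
  then show "finite (words_after_Rt n)"
    by (simp add: words_after_Rt_def)
qed

lemma sum_words_Suc:
  fixes f :: "letter list \<Rightarrow> nat"
  shows "sum f (words (Suc n)) =
    (\<Sum>c\<in>UNIV. \<Sum>xs\<in>tails n c. f (c # xs))"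
    "sum f (words_after_Rt (Suc n)) =
    (\<Sum>c\<in>-{Lf}. \<Sum>xs\<in>tails n c. f (c # xs))"
proof -
  have *: "sum f (\<Union>c\<in>C. (#) c ` tails n c) =
      (\<Sum>c\<in>C. \<Sum>xs\<in>tails n c. f (c # xs))" for C
  proof -
    have "finite C"
      by (rule finite_subset[OF subset_UNIV]) (simp add: UNIV_letter)
    then have "sum f (\<Union>c\<in>C. (#) c ` tails n c) =
      (\<Sum>c\<in>C. sum f ((#) c ` tails n c))"
      by (intro sum.UNION_disjoint) (auto simp: finite_words tails_def)
    then show ?thesis
      by (simp add: sum.reindex)
  qed
  show "sum f (words (Suc n)) =
    (\<Sum>c\<in>UNIV. \<Sum>xs\<in>tails n c. f (c # xs))"
    unfolding words_Suc(1) by (rule *)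
  show "sum f (words_after_Rt (Suc n)) =
    (\<Sum>c\<in>-{Lf}. \<Sum>xs\<in>tails n c. f (c # xs))"
    unfolding words_Suc(2) by (rule *)
qed

definition total_weight :: "letter list set \<Rightarrow> nat" where
  "total_weight X = (\<Sum>xs\<in>X. \<Sum>x\<leftarrow>xs. weight x)"

lemma compl_Lf: "- {Lf} = {N False False, N False True, N True False, N True True, Rt}"
  unfolding Compl_eq_Diff_UNIV UNIV_letter by auto

lemma card_words_Suc:
  "card (words (Suc n)) = 5 * card (words n) + card (words_after_Rt n)"
  "card (words_after_Rt (Suc n)) = 4 * card (words n) + card (words_after_Rt n)"
  using sum_words_Suc[of "\<lambda>_. 1" n] by (simp_all add: UNIV_letter compl_Lf tails_def)

lemma total_weight_words_Suc:
  "total_weight (words (Suc n)) = 5 * total_weight (words n) + total_weight (words_after_Rt n)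
     + 11 * card (words n) + card (words_after_Rt n)"
  "total_weight (words_after_Rt (Suc n)) = 4 * total_weight (words n) + total_weight (words_after_Rt n)
     + 10 * card (words n) + card (words_after_Rt n)"
  unfolding total_weight_def sum_words_Suc
  by (simp_all add: UNIV_letter compl_Lf tails_def sum.distrib)

lemma words_0: "words 0 = {[]}" "words_after_Rt 0 = {[]}"
  by (auto simp: words_def words_after_Rt_def valid_def)

lemma total_weight_closed_form:
  "8 * real (total_weight (words n)) =
     real n * (14 * real (card (words n)) + 3 * real (card (words_after_Rt n)))
     - 3 * (real (card (words n)) - real (card (words_after_Rt n)))"
  "4 * real (total_weight (words_after_Rt n)) =
     real n * (6 * real (card (words n)) + real (card (words_after_Rt n)))
     + 3 * (real (card (words n)) - real (card (words_after_Rt n)))"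
proof (induction n)
  case 0
  case 1 show ?case by (simp add: words_0 total_weight_def)
  case 2 show ?case by (simp add: words_0 total_weight_def)
next
  case (Suc n)
  case 1
  show ?case using Suc by (simp add: total_weight_words_Suc card_words_Suc algebra_simps)
  case 2
  show ?case using Suc by (simp add: total_weight_words_Suc card_words_Suc algebra_simps)
qed

lemma card_words_pos: "card (words n) > 0"
  by (induction n) (simp_all add: words_0 card_words_Suc)

text \<open>The ratio evolves under the Moebius map \<open>r \<mapsto> (4 + r) / (5 + r)\<close>, which contracts towards its
  positive fixed point \<open>2 \<surd>2 - 2\<close>.\<close>

lemma card_ratio_tendsto:
  "(\<lambda>n. real (card (words_after_Rt n)) / real (card (words n))) \<longlonglongrightarrow> 2 * sqrt 2 - 2"
proof -
  define r where "r = (\<lambda>n. real (card (words_after_Rt n)) / real (card (words n)))"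
  define l where "l = 2 * sqrt 2 - 2"
  have l: "l \<ge> 0" "l * (5 + l) = 4 + l"
    by (auto simp: l_def algebra_simps)
  have r0: "r n \<ge> 0" for n
    by (simp add: r_def)
  have r_Suc: "r (Suc n) = (4 + r n) / (5 + r n)" for n
  proof -
    define a b where "a = real (card (words n))" and "b = real (card (words_after_Rt n))"
    have "a > 0"
      using card_words_pos[of n] by (simp add: a_def)
    then have "(4 * a + b) / (5 * a + b) = (a * (4 + b / a)) / (a * (5 + b / a))"
      by (simp add: distrib_left mult.commute)
    then show ?thesis
      using \<open>a > 0\<close> by (simp add: r_def card_words_Suc a_def b_def)
  qed
  have step: "\<bar>r (Suc n) - l\<bar> \<le> \<bar>r n - l\<bar> / 25" for n
  proof -
    have "l = (4 + l) / (5 + l)"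
      using l by (simp add: eq_divide_eq)
    then have "r (Suc n) - l = (4 + r n) / (5 + r n) - (4 + l) / (5 + l)"
      by (simp add: r_Suc)
    also have "\<dots> = (r n - l) / ((5 + r n) * (5 + l))"
      using r0[of n] l(1) by (simp add: divide_simps) (simp add: algebra_simps)
    finally have "\<bar>r (Suc n) - l\<bar> = \<bar>r n - l\<bar> / ((5 + r n) * (5 + l))"
      using r0[of n] l(1) by (simp add: abs_mult)
    moreover have "25 \<le> (5 + r n) * (5 + l)"
      using mult_mono[of 5 "5 + r n" 5 "5 + l"] r0[of n] l(1) by simp
    then have "\<bar>r n - l\<bar> / ((5 + r n) * (5 + l)) \<le> \<bar>r n - l\<bar> / 25"
      by (intro divide_left_mono) auto
    ultimately show ?thesis
      by simp
  qed
  have bound: "\<bar>r n - l\<bar> \<le> \<bar>r 0 - l\<bar> * (1 / 25) ^ n" for n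
  proof (induction n)
    case (Suc n)
    then show ?case using step[of n] by simp
  qed simp
  have "(\<lambda>n. \<bar>r 0 - l\<bar> * (1 / 25) ^ n) \<longlonglongrightarrow> 0"
    by (intro tendsto_mult_right_zero LIMSEQ_power_zero) simp
  then have "(\<lambda>n. \<bar>r n - l\<bar>) \<longlonglongrightarrow> 0"
    by (rule tendsto_sandwich[where f = "\<lambda>_. 0", rotated 3]) (use bound in simp_all)
  then have "(\<lambda>n. r n - l) \<longlonglongrightarrow> 0"
    by (rule tendsto_rabs_zero_cancel)
  then show ?thesis
    by (simp add: LIM_zero_iff r_def l_def)
qed

theorem corollary4p5:
  shows "(\<lambda>n. real (pyrene_AF n) / (real n * real (pyrene_Phi n)))
           \<longlonglongrightarrow> 1 + 3 * sqrt 2 / 4"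
proof -
  define r where "r = (\<lambda>n. real (card (words_after_Rt n)) / real (card (words n)))"
  have r: "r \<longlonglongrightarrow> 2 * sqrt 2 - 2"
    unfolding r_def by (rule card_ratio_tendsto)
  have "(\<lambda>n. (14 + 3 * r n) / 8 - 3 / 8 * (1 - r n) * (1 / real n)) \<longlonglongrightarrow>
      (14 + 3 * (2 * sqrt 2 - 2)) / 8 - 3 / 8 * (1 - (2 * sqrt 2 - 2)) * 0"
    by (intro tendsto_intros r lim_1_over_n) simp
  moreover have "\<forall>\<^sub>F n in sequentially. (14 + 3 * r n) / 8 - 3 / 8 * (1 - r n) * (1 / real n) =
      real (pyrene_AF n) / (real n * real (pyrene_Phi n))"
  proof (rule eventually_sequentiallyI[of 1])
    fix n :: nat assume "1 \<le> n"
    then have n: "n > 0" by simp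
    have AF: "real (pyrene_AF n) = real (total_weight (words n))"
      by (simp add: pyrene_AF_eq[OF n] total_weight_def)
    have b: "real (card (words_after_Rt n)) = r n * real (card (words n))"
      using card_words_pos[of n] by (simp add: r_def)
    have "8 * real (pyrene_AF n) = (real n * (14 + 3 * r n) - 3 * (1 - r n)) * real (card (words n))"
      unfolding AF total_weight_closed_form b by (simp add: algebra_simps)
    then have AF_r: "real (pyrene_AF n) =
        (real n * (14 + 3 * r n) - 3 * (1 - r n)) / 8 * real (card (words n))"
      by simp
    have "(14 + 3 * r n) / 8 - 3 / 8 * (1 - r n) * (1 / real n) =
        (real n * (14 + 3 * r n) - 3 * (1 - r n)) / 8 / real n"
      using n by (simp add: field_simps)
    then show "(14 + 3 * r n) / 8 - 3 / 8 * (1 - r n) * (1 / real n) =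
        real (pyrene_AF n) / (real n * real (pyrene_Phi n))"
      unfolding AF_r pyrene_Phi_eq[OF n] using card_words_pos[of n] by simp
  qed
  ultimately have "(\<lambda>n. real (pyrene_AF n) / (real n * real (pyrene_Phi n))) \<longlonglongrightarrow>
      (14 + 3 * (2 * sqrt 2 - 2)) / 8 - 3 / 8 * (1 - (2 * sqrt 2 - 2)) * 0"
    by (rule Lim_transform_eventually)
  then show ?thesis
    by (simp add: algebra_simps add_divide_distrib diff_divide_distrib)
qed

end
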